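(* Let $\mathcal{H}$ be a real Hilbert space, $A:\mathcal{H}\rightrightarrows\mathcal{H}$ a maximally monotone operator, $D:\mathcal{H}\to\mathcal{H}$ a monotone and $\eta^{-1}$-Lipschitz continuous operator with $\eta>0$, $B:\mathcal{H}\to\mathcal{H}$ a monotone and $\mu^{-1}$-Lipschitz continuous operator with $\mu>0$, and suppose that $C:=\operatorname{zer}B\neq\emptyset$. Let $(\lambda_n)_{n\ge 0}$ and $(\beta_n)_{n\ge 0}$ be sequences of positive real numbers. Let $x_0\in\mathcal{H}$, $y_{-1}=x_0$, and let $(x_n)_{n\ge 0}$, $(y_n)_{n\ge -1}$ be generated for all $n\ge 0$ by $$y_n=J_{\lambda_nA}\big[x_n-\lambda_nD(y_{n-1})-\lambda_n\beta_nB(y_{n-1})\big],$$ $$x_{n+1}=\lambda_n\beta_n\big[B(y_{n-1})-B(y_n)\big]+\lambda_n\big[D(y_{n-1})-D(y_n)\big]+y_n.$$ Let $z_n=\frac{1}{\tau_n}\sum_{k=0}^n\lambda_kx_k$ with $\tau_n=\sum_{k=0}^n\lambda_k$. Assume that: (i) $A+N_C$ is maximally monotone and $\operatorname{zer}(A+D+N_C)\neq\emptyset$; (ii) for every $p\in\operatorname{ran}(N_C)$, $\sum_{n\ge 0}\lambda_n\beta_n\Big[\sup_{u\in C}\varphi_B\big(u,\tfrac{p}{\beta_n}\big)-\sigma_C\big(\tfrac{p}{\beta_n}\big)\Big]<+\infty$; (iii) $(\lambda_n)_{n\ge 0}\in\ell^2\setminus\ell^1$; and that $\limsup_{n\to+\infty}\Big(\frac{\lambda_n\beta_n}{\mu}+\frac{\lambda_n}{\eta}\Big)<\frac12$.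 Then $(z_n)_{n\ge 0}$ converges weakly to an element of $\operatorname{zer}(A+D+N_C)$ as $n\to+\infty$.
   Context: For a set-valued operator $T:\mathcal{H}\rightrightarrows\mathcal{H}$: $\operatorname{Gr}T=\{(x,u):u\in Tx\}$, $\operatorname{zer}T=\{x:0\in Tx\}$, $\operatorname{ran}T=\{u:\exists x,\ u\in Tx\}$. The resolvent is $J_T=(\mathrm{Id}+T)^{-1}$, which is single-valued and everywhere defined when $T$ is maximally monotone. $N_C$ is the normal cone of the closed convex set $C$: $N_C(x)=\{u:\langle y-x,u\rangle\le 0\ \forall y\in C\}$ if $x\in C$, and $N_C(x)=\emptyset$ otherwise. The support function is $\sigma_C(u)=\sup_{y\in C}\langle y,u\rangle$. The Fitzpatrick function of a monotone operator $B$ is $\varphi_B(x,u)=\sup_{(y,v)\in\operatorname{Gr}B}\{\langle x,v\rangle+\langle y,u\rangle-\langle y,v\rangle\}\in\mathbb{R}\cup\{\pm\infty\}$. *)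

theory Defs
  imports "HOL-Analysis.Analysis"
begin

text \<open>Set-valued operators on \<open>'a\<close> are functions of type \<open>'a \<Rightarrow> 'a set\<close>.\<close>

definition op_graph :: "('a \<Rightarrow> 'a set) \<Rightarrow> ('a \<times> 'a) set" where
  "op_graph T = {(x, u). u \<in> T x}"

definition zer :: "('a::zero \<Rightarrow> 'a set) \<Rightarrow> 'a set" where
  "zer T = {x. 0 \<in> T x}"

definition op_ran :: "('a \<Rightarrow> 'a set) \<Rightarrow> 'a set" where
  "op_ran T = {u. \<exists>x. u \<in> T x}"

definition op_inverse :: "('a \<Rightarrow> 'a set) \<Rightarrow> ('a \<Rightarrow> 'a set)" where
  "op_inverse T u = {x. u \<in> T x}"

definition single_op :: "('a \<Rightarrow> 'a) \<Rightarrow> ('a \<Rightarrow> 'a set)" where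
  "single_op F x = {F x}"

text \<open>The sum on the right-hand side is the Minkowski sum of sets, so \<open>op_plus S T x\<close> is empty as
  soon as \<open>S x\<close> or \<open>T x\<close> is.\<close>

definition op_plus :: "('a::plus \<Rightarrow> 'a set) \<Rightarrow> ('a \<Rightarrow> 'a set) \<Rightarrow> ('a \<Rightarrow> 'a set)"
    (infixl "+\<^sub>o" 65) where
  "(S +\<^sub>o T) x = S x + T x"

definition op_scale :: "real \<Rightarrow> ('a::real_vector \<Rightarrow> 'a set) \<Rightarrow> ('a \<Rightarrow> 'a set)"
    (infixr "*\<^sub>o" 75) where
  "(c *\<^sub>o T) x = (\<lambda>u. c *\<^sub>R u) ` T x"

definition monotone_op :: "('a::real_inner \<Rightarrow> 'a set) \<Rightarrow> bool" where
  "monotone_op T \<longleftrightarrow>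
     (\<forall>(x, u) \<in> op_graph T. \<forall>(y, v) \<in> op_graph T. (x - y) \<bullet> (u - v) \<ge> 0)"

definition maximally_monotone :: "('a::real_inner \<Rightarrow> 'a set) \<Rightarrow> bool" where
  "maximally_monotone T \<longleftrightarrow>
     monotone_op T \<and> (\<forall>S. monotone_op S \<and> op_graph T \<subseteq> op_graph S \<longrightarrow> op_graph S = op_graph T)"

text \<open>The set-valued inverse of \<open>Id + T\<close> is single-valued and everywhere defined for maximally
  monotone \<open>T\<close>; only then is the value below meaningful.\<close>

definition resolvent :: "('a::real_inner \<Rightarrow> 'a set) \<Rightarrow> 'a \<Rightarrow> 'a" where
  "resolvent T x = the_elem (op_inverse (single_op id +\<^sub>o T) x)"

definition normal_cone :: "'a::real_inner set \<Rightarrow> ('a \<Rightarrow> 'a set)" where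
  "normal_cone C x = (if x \<in> C then {u. \<forall>y\<in>C. (y - x) \<bullet> u \<le> 0} else {})"

definition support_fun :: "'a::real_inner set \<Rightarrow> 'a \<Rightarrow> ereal" where
  "support_fun C u = (SUP y\<in>C. ereal (y \<bullet> u))"

definition fitzpatrick :: "('a::real_inner \<Rightarrow> 'a set) \<Rightarrow> 'a \<Rightarrow> 'a \<Rightarrow> ereal" where
  "fitzpatrick T x u = (SUP (y, v) \<in> op_graph T. ereal (x \<bullet> v + y \<bullet> u - y \<bullet> v))"

definition weakly_converges :: "(nat \<Rightarrow> 'a::real_inner) \<Rightarrow> 'a \<Rightarrow> bool" where
  "weakly_converges z l \<longleftrightarrow> (\<forall>h. (\<lambda>n. z n \<bullet> h) \<longlonglongrightarrow> l \<bullet> h)"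

end

theory Submission
  imports Defs
begin

text \<open>
  With \<open>b\<^sub>n = (x\<^sub>n - x\<^sub>n\<^sub>+\<^sub>1) / \<lambda>\<^sub>n - D y\<^sub>n - \<beta>\<^sub>n B y\<^sub>n \<in> A y\<^sub>n\<close>, monotonicity of \<open>A\<close> and \<open>D\<close> together with the
  Fitzpatrick inequality shows, for every \<open>(u, w)\<close> in the graph of \<open>A + D + N\<^sub>C\<close>, that the energy
  \<open>\<parallel>x\<^sub>n - u\<parallel>\<^sup>2 + \<parallel>x\<^sub>n - y\<^sub>n\<^sub>-\<^sub>1\<parallel>\<^sup>2\<close> decreases by at least \<open>c \<parallel>y\<^sub>n - y\<^sub>n\<^sub>-\<^sub>1\<parallel>\<^sup>2 + 2 \<lambda>\<^sub>n \<langle>w, y\<^sub>n - u\<rangle>\<close> up to a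
  summable error; \<open>c > 0\<close> because the step sizes are eventually below a bound less than \<open>1/2\<close>.
  For \<open>w = 0\<close> this makes \<open>\<parallel>x\<^sub>n - u\<parallel>\<close> convergent; for general \<open>w\<close>, summation and division by \<open>\<tau>\<^sub>n\<close>
  shows that every weak cluster point \<open>q\<close> of the averages satisfies \<open>\<langle>w, q - u\<rangle> \<le> 0\<close>, hence is a
  zero by maximality of \<open>A + D + N\<^sub>C\<close>. Opial's argument then gives uniqueness of the cluster point.

  No weak topology is needed: a weak cluster point is encoded as a point satisfying every half-space
  constraint that eventually holds along the sequence, and such points come from nested closed
  convex sets.
\<close>

subsection \<open>Surjectivity and perturbation of maximally monotone operators\<close>

lemma Cauchy_if_dist_square_le:
  fixes f :: "nat \<Rightarrow> 'a::real_normed_vector"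
  assumes "\<And>m n. m \<le> n \<Longrightarrow> (norm (f m - f n))\<^sup>2 \<le> r m" and "r \<longlonglongrightarrow> 0"
  shows "Cauchy f"
proof (rule CauchyI)
  fix e :: real assume "e > 0"
  then have "\<forall>\<^sub>F m in sequentially. r m < (e/2)\<^sup>2"
    using order_tendstoD(2)[OF assms(2), of "(e/2)\<^sup>2"] by simp
  then obtain M where M: "r M < (e/2)\<^sup>2" by (auto simp: eventually_sequentially)
  have near: "norm (f M - f n) < e/2" if "n \<ge> M" for n
    using power_less_imp_less_base[of "norm (f M - f n)" 2 "e/2"] assms(1)[OF that] M \<open>e > 0\<close>
    by linarith
  show "\<exists>M. \<forall>m\<ge>M. \<forall>n\<ge>M. norm (f m - f n) < e"
  proof (intro exI allI impI)
    fix m n assume "m \<ge> M" "n \<ge> M"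
    then show "norm (f m - f n) < e"
      using near[of m] near[of n] norm_triangle_ineq4[of "f M - f n" "f M - f m"] by simp
  qed
qed

text \<open>The parallelogram law, with the midpoint written as a convex combination:
  near-minimisers over a convex set are compared through it.\<close>

lemma norm_diff_square_midpoint:
  fixes a b :: "'a::real_inner"
  shows "(norm (a - b))\<^sup>2
    = 2 * (norm a)\<^sup>2 + 2 * (norm b)\<^sup>2 - 4 * (norm ((1/2) *\<^sub>R a + (1/2) *\<^sub>R b))\<^sup>2"
  by (simp add: power2_norm_eq_inner inner_add_left inner_add_right inner_diff_left
      inner_diff_right inner_commute[of b a] field_simps)

text \<open>The half-space inequality against generators is applied twice: first to one argument, then
  to the other, which amounts to expanding the double sum of a convex combination.\<close>

lemma convex_hull_graph_inner_le:
  fixes G :: "('a::real_inner \<times> 'a) set"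
  assumes mono: "\<And>y v y' v'. (y, v) \<in> G \<Longrightarrow> (y', v') \<in> G \<Longrightarrow> 0 \<le> (y - y') \<bullet> (v - v')"
    and "(a, b, s) \<in> convex hull ((\<lambda>(y, v). (y, v, y \<bullet> v)) ` G)"
  shows "a \<bullet> b \<le> s"
proof -
  let ?P = "(\<lambda>(y, v). (y, v, y \<bullet> v)) ` G"
  have cvx: "convex {(a', b', s'). a' \<bullet> d + c \<bullet> b' \<le> s' + k}" for c d :: 'a and k
  proof (rule convexI, clarsimp)
    fix a1 b1 :: 'a and s1 and a2 b2 :: 'a and s2 and t r :: real
    assume h: "a1 \<bullet> d + c \<bullet> b1 \<le> s1 + k" "a2 \<bullet> d + c \<bullet> b2 \<le> s2 + k" and tr: "0 \<le> t" "0 \<le> r" "t + r = 1"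
    have "t * (a1 \<bullet> d + c \<bullet> b1) + r * (a2 \<bullet> d + c \<bullet> b2) \<le> t * (s1 + k) + r * (s2 + k)"
      by (intro add_mono mult_left_mono h tr)
    also have "\<dots> = t * s1 + r * s2 + (t + r) * k" by (simp add: algebra_simps)
    also have "\<dots> = t * s1 + r * s2 + k" using tr(3) by simp
    finally show "(t *\<^sub>R a1 + r *\<^sub>R a2) \<bullet> d + c \<bullet> (t *\<^sub>R b1 + r *\<^sub>R b2) \<le> t * s1 + r * s2 + k"
      by (simp add: algebra_simps)
  qed
  have 1: "a' \<bullet> v + y \<bullet> b' \<le> s' + y \<bullet> v"
    if "(y, v) \<in> G" "(a', b', s') \<in> convex hull ?P" for y v a' b' s'
  proof -
    have "?P \<subseteq> {(a', b', s'). a' \<bullet> v + y \<bullet> b' \<le> s' + y \<bullet> v}"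
      using mono[OF _ that(1)] by (auto simp: inner_diff_left inner_diff_right algebra_simps)
    from hull_minimal[of _ _ convex, OF this cvx[of v y "y \<bullet> v"]] that(2) show ?thesis by auto
  qed
  have "?P \<subseteq> {(a', b', s'). a' \<bullet> b + a \<bullet> b' \<le> s' + s}"
    using 1[OF _ assms(2)] by (auto simp: algebra_simps)
  from hull_minimal[of _ _ convex, OF this cvx[of b a s]] assms(2) have "a \<bullet> b + a \<bullet> b \<le> s + s" by auto
  then show ?thesis by simp
qed

text \<open>The Fitzpatrick-type dual of the inclusion: minimise \<open>\<parallel>(a - b)/2\<parallel>\<^sup>2 + s\<close> over the convex hull of
  the triples \<open>(y, v, y \<bullet> v)\<close>. The infimum is nonnegative, minimising sequences have Cauchy
  first part by strong convexity, and first-order optimality of the limit is the claim.\<close>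

lemma monotone_graph_related_point:
  fixes G :: "('a::{real_inner,complete_space} \<times> 'a) set"
  assumes mono: "\<And>y v y' v'. (y, v) \<in> G \<Longrightarrow> (y', v') \<in> G \<Longrightarrow> 0 \<le> (y - y') \<bullet> (v - v')"
    and "G \<noteq> {}"
  obtains x where "\<And>y v. (y, v) \<in> G \<Longrightarrow> 0 \<le> (y - x) \<bullet> (v + x)"
proof -
  define H where "H = convex hull ((\<lambda>(y, v). (y, v, y \<bullet> v)) ` G)"
  define Q :: "'a \<times> 'a \<times> real \<Rightarrow> 'a" where "Q = (\<lambda>(a, b, s). (1/2) *\<^sub>R (a - b))"
  define S :: "'a \<times> 'a \<times> real \<Rightarrow> real" where "S = (\<lambda>(a, b, s). s)"
  define F where "F h = (norm (Q h))\<^sup>2 + S h" for h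
  have G_H: "(y, v, y \<bullet> v) \<in> H" if "(y, v) \<in> G" for y v
    using that hull_subset[of "(\<lambda>(y, v). (y, v, y \<bullet> v)) ` G" convex] unfolding H_def by force
  have "H \<noteq> {}" using G_H \<open>G \<noteq> {}\<close> by force
  have comb: "Q (t *\<^sub>R g + r *\<^sub>R h) = t *\<^sub>R Q g + r *\<^sub>R Q h"
       "S (t *\<^sub>R g + r *\<^sub>R h) = t * S g + r * S h" for t r g h
    by (auto simp: Q_def S_def algebra_simps split: prod.splits)
  have F_nonneg: "F h \<ge> 0" if "h \<in> H" for h
  proof (cases h)
    case (fields a b s)
    then have "a \<bullet> b \<le> s" using convex_hull_graph_inner_le[OF mono, of G a b s] that
      by (auto simp: H_def)
    \<comment> \<open>By polarisation, \<open>F h\<close> is a square plus the defect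
      \<open>s - a \<bullet> b\<close>, which is nonnegative on the hull.\<close>
    moreover have "(norm ((1/2) *\<^sub>R (a - b)))\<^sup>2 + a \<bullet> b = (norm ((1/2) *\<^sub>R (a + b)))\<^sup>2"
      by (simp add: power2_norm_eq_inner inner_add_left inner_add_right inner_diff_left
          inner_diff_right inner_commute[of b a] field_simps)
    ultimately show ?thesis using zero_le_power2[of "norm ((1/2) *\<^sub>R (a + b))"]
      unfolding F_def Q_def S_def fields prod.case by linarith
  qed
  define m where "m = Inf (F ` H)"
  have bdd: "bdd_below (F ` H)" using F_nonneg by (auto intro!: bdd_belowI)
  have m_le: "m \<le> F h" if "h \<in> H" for h
    unfolding m_def using bdd that by (auto intro: cInf_lower)
  have "m \<ge> 0" unfolding m_def using F_nonneg \<open>H \<noteq> {}\<close> by (auto intro: cInf_greatest)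
  have "\<exists>h. h \<in> H \<and> F h < m + inverse (real (Suc n))" for n
    using cInf_lessD[of "F ` H" "m + inverse (real (Suc n))"] \<open>H \<noteq> {}\<close> unfolding m_def by auto
  then obtain h where h: "\<And>n. h n \<in> H" "\<And>n. F (h n) < m + inverse (real (Suc n))" by metis
  have "(norm (Q (h i) - Q (h j)))\<^sup>2 \<le> 4 * inverse (real (Suc i))" if "i \<le> j" for i j
  proof -
    have "(1/2) *\<^sub>R h i + (1/2) *\<^sub>R h j \<in> H"
      using h(1) unfolding H_def by (intro convexD[OF convex_convex_hull]) auto
    from m_le[OF this] have "4 * m \<le> 4 * (norm ((1/2) *\<^sub>R Q (h i) + (1/2) *\<^sub>R Q (h j)))\<^sup>2
        + 2 * S (h i) + 2 * S (h j)"
      by (simp add: F_def comb)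
    moreover have "inverse (real (Suc j)) \<le> inverse (real (Suc i))"
      using that by (simp add: field_simps)
    ultimately show ?thesis
      using norm_diff_square_midpoint[of "Q (h i)" "Q (h j)"] h(2)[of i] h(2)[of j]
      unfolding F_def by linarith
  qed
  moreover have "(\<lambda>i. 4 * inverse (real (Suc i))) \<longlonglongrightarrow> 0"
    using tendsto_mult_right_zero[OF LIMSEQ_inverse_real_of_nat] by blast
  ultimately have "Cauchy (\<lambda>n. Q (h n))" by (rule Cauchy_if_dist_square_le)
  then obtain x where x: "(\<lambda>n. Q (h n)) \<longlonglongrightarrow> x"
    using Cauchy_convergent convergent_def by blast
  have "(\<lambda>n. F (h n)) \<longlonglongrightarrow> m"
  proof (rule tendsto_sandwich[of "\<lambda>_. m" _ _ "\<lambda>n. m + inverse (real (Suc n))"])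
    show "(\<lambda>n. m + inverse (real (Suc n))) \<longlonglongrightarrow> m"
      using tendsto_add[OF tendsto_const LIMSEQ_inverse_real_of_nat, of m] by simp
  qed (use h m_le in \<open>auto intro!: always_eventually less_imp_le\<close>)
  \<comment> \<open>The hull points are not shown to converge; \<open>F\<close> sees them only
    through \<open>Q\<close> and \<open>S\<close>, whose limits suffice below.\<close>
  then have "(\<lambda>n. F (h n) - (norm (Q (h n)))\<^sup>2) \<longlonglongrightarrow> m - (norm x)\<^sup>2"
    by (intro tendsto_intros x)
  then have S_lim: "(\<lambda>n. S (h n)) \<longlonglongrightarrow> m - (norm x)\<^sup>2" by (simp add: F_def)
  show thesis
  proof
    fix y v assume "(y, v) \<in> G"
    define g where "g = (y, v, y \<bullet> v)"
    have "g \<in> H" using G_H[OF \<open>(y, v) \<in> G\<close>] by (simp add: g_def)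
    \<comment> \<open>Moving from the limit towards \<open>g\<close> by \<open>t\<close> cannot push
      the objective below \<open>m\<close>. Cancelling \<open>m\<close> and one factor
      \<open>t\<close>, then letting \<open>t\<close> tend to \<open>0\<close>, gives the
      first-order condition.\<close>
    have pert: "0 \<le> t * (norm (Q g - x))\<^sup>2 + (2 * (x \<bullet> Q g) - (norm x)\<^sup>2 + S g - m)" if "0 < t" "t \<le> 1" for t
    proof -
      have "m \<le> F ((1 - t) *\<^sub>R h n + t *\<^sub>R g)" for n
        using h(1) \<open>g \<in> H\<close> that unfolding H_def
        by (intro m_le[unfolded H_def] convexD[OF convex_convex_hull]) auto
      then have "m \<le> (norm ((1 - t) *\<^sub>R Q (h n) + t *\<^sub>R Q g))\<^sup>2 + ((1 - t) * S (h n) + t * S g)" for n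
        by (simp add: F_def comb)
      moreover have "(\<lambda>n. (norm ((1 - t) *\<^sub>R Q (h n) + t *\<^sub>R Q g))\<^sup>2 + ((1 - t) * S (h n) + t * S g))
          \<longlonglongrightarrow> (norm ((1 - t) *\<^sub>R x + t *\<^sub>R Q g))\<^sup>2 + ((1 - t) * (m - (norm x)\<^sup>2) + t * S g)"
        by (intro tendsto_intros x S_lim)
      ultimately have "m \<le> (norm ((1 - t) *\<^sub>R x + t *\<^sub>R Q g))\<^sup>2 + ((1 - t) * (m - (norm x)\<^sup>2) + t * S g)"
        by (intro tendsto_lowerbound) auto
      also have "\<dots> = m + t * (t * (norm (Q g - x))\<^sup>2 + (2 * (x \<bullet> Q g) - (norm x)\<^sup>2 + S g - m))"
        by (simp add: power2_norm_eq_inner inner_add_left inner_add_right inner_diff_left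
            inner_diff_right inner_commute[of "Q g" x] algebra_simps)
      finally show ?thesis using that by (simp add: zero_le_mult_iff)
    qed
    have "((\<lambda>t. t * (norm (Q g - x))\<^sup>2 + (2 * (x \<bullet> Q g) - (norm x)\<^sup>2 + S g - m)) \<longlongrightarrow>
        0 * (norm (Q g - x))\<^sup>2 + (2 * (x \<bullet> Q g) - (norm x)\<^sup>2 + S g - m)) (at_right 0)"
      by (intro tendsto_intros)
    moreover have "\<forall>\<^sub>F t in at_right 0. 0 \<le> t * (norm (Q g - x))\<^sup>2 + (2 * (x \<bullet> Q g) - (norm x)\<^sup>2 + S g - m)"
      unfolding eventually_at_right_field using pert by (intro exI[of _ 1]) auto
    ultimately have "0 \<le> 0 * (norm (Q g - x))\<^sup>2 + (2 * (x \<bullet> Q g) - (norm x)\<^sup>2 + S g - m)"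
      by (rule tendsto_lowerbound) simp
    \<comment> \<open>Since \<open>Q g\<close> is half of \<open>y - v\<close>, the condition says
      that this inner product is at least \<open>m\<close>.\<close>
    then show "0 \<le> (y - x) \<bullet> (v + x)"
      using \<open>m \<ge> 0\<close> unfolding g_def Q_def S_def
      by (simp add: power2_norm_eq_inner inner_add_left inner_add_right inner_diff_left
          inner_diff_right inner_commute[of y x] algebra_simps)
  qed
qed

text \<open>Maximality can be tested one point at a time: a point monotonically related to the whole
  graph could be adjoined without losing monotonicity.\<close>

lemma maximally_monotone_iff:
  "maximally_monotone T \<longleftrightarrow> monotone_op T \<and>
     (\<forall>x u. (\<forall>y v. v \<in> T y \<longrightarrow> 0 \<le> (x - y) \<bullet> (u - v)) \<longrightarrow> u \<in> T x)"
proof (intro iffI conjI allI impI)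
  assume max: "maximally_monotone T"
  then show mono: "monotone_op T" by (simp add: maximally_monotone_def)
  fix x u assume rel: "\<forall>y v. v \<in> T y \<longrightarrow> 0 \<le> (x - y) \<bullet> (u - v)"
  define S where "S = T(x := insert u (T x))"
  have S_iff: "v \<in> S y \<longleftrightarrow> v \<in> T y \<or> y = x \<and> v = u" for y v by (auto simp: S_def)
  have "monotone_op S"
    using mono rel unfolding monotone_op_def op_graph_def
    by (auto simp: S_iff inner_diff_left inner_diff_right algebra_simps)
  moreover have "op_graph T \<subseteq> op_graph S" by (auto simp: op_graph_def S_iff)
  ultimately have "op_graph S = op_graph T" using max by (simp add: maximally_monotone_def)
  then show "u \<in> T x" by (auto simp: op_graph_def S_iff set_eq_iff)
next
  assume *: "monotone_op T \<and>
     (\<forall>x u. (\<forall>y v. v \<in> T y \<longrightarrow> 0 \<le> (x - y) \<bullet> (u - v)) \<longrightarrow> u \<in> T x)"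
  show "maximally_monotone T"
    unfolding maximally_monotone_def
  proof (intro conjI allI impI)
    fix S assume S: "monotone_op S \<and> op_graph T \<subseteq> op_graph S"
    show "op_graph S = op_graph T"
    proof
      show "op_graph S \<subseteq> op_graph T"
      proof clarify
        fix x u assume "(x, u) \<in> op_graph S"
        then have "\<forall>y v. v \<in> T y \<longrightarrow> 0 \<le> (x - y) \<bullet> (u - v)"
          using S unfolding monotone_op_def op_graph_def by blast
        then show "(x, u) \<in> op_graph T" using * by (simp add: op_graph_def)
      qed
    qed (use S in simp)
  qed (use * in simp)
qed

lemma monotone_opD:
  "monotone_op T \<Longrightarrow> u \<in> T x \<Longrightarrow> v \<in> T y \<Longrightarrow> 0 \<le> (x - y) \<bullet> (u - v)"
  by (auto simp: monotone_op_def op_graph_def)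

lemma monotone_single_opD:
  "monotone_op (single_op F) \<Longrightarrow> 0 \<le> (x - y) \<bullet> (F x - F y)"
  by (rule monotone_opD) (auto simp: single_op_def)

text \<open>Apply \<open>monotone_graph_related_point\<close> to the graph of
  \<open>c T - w\<close>: the point \<open>(x, - x)\<close> is monotonically related to it, so
  \<open>(x, (w - x) / c)\<close> is related to the graph of \<open>T\<close> and lies there by
  maximality.\<close>

lemma minty:
  fixes T :: "'a::{real_inner,complete_space} \<Rightarrow> 'a set"
  assumes T: "maximally_monotone T" and "c > 0"
  obtains x u where "u \<in> T x" "x + c *\<^sub>R u = w"
proof -
  define G where "G = {(y, c *\<^sub>R v - w) |y v. v \<in> T y}"
  have mono: "monotone_op T"
    and max: "\<And>x u. (\<And>y v. v \<in> T y \<Longrightarrow> 0 \<le> (x - y) \<bullet> (u - v)) \<Longrightarrow> u \<in> T x"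
    using T by (auto simp: maximally_monotone_iff)
  have "0 \<le> (y - y') \<bullet> (v - v')" if "(y, v) \<in> G" "(y', v') \<in> G" for y v y' v'
  proof -
    from that obtain b b' where b: "b \<in> T y" "b' \<in> T y'" "v = c *\<^sub>R b - w" "v' = c *\<^sub>R b' - w"
      by (auto simp: G_def)
    have "v - v' = c *\<^sub>R (b - b')" unfolding b(3,4) by (simp add: algebra_simps)
    then show ?thesis using monotone_opD[OF mono b(1,2)] \<open>c > 0\<close> by simp
  qed
  \<comment> \<open>Were the graph empty, \<open>(0, 0)\<close> would be vacuously related to it and
    hence belong to it.\<close>
  moreover have "\<exists>y v. v \<in> T y" using max[of 0 0] by blast
  then have "G \<noteq> {}" unfolding G_def by blast
  ultimately obtain x where x: "\<And>y v. (y, v) \<in> G \<Longrightarrow> 0 \<le> (y - x) \<bullet> (v + x)"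
    by (rule monotone_graph_related_point) auto
  have "(1 / c) *\<^sub>R (w - x) \<in> T x"
  proof (rule max)
    fix y v assume "v \<in> T y"
    then have "0 \<le> (y - x) \<bullet> (c *\<^sub>R v - w + x)" by (intro x) (auto simp: G_def)
    also have "\<dots> = c * ((x - y) \<bullet> ((1 / c) *\<^sub>R (w - x) - v))"
      using \<open>c > 0\<close> by (simp add: inner_diff_left inner_diff_right inner_add_right algebra_simps)
    finally show "0 \<le> (x - y) \<bullet> ((1 / c) *\<^sub>R (w - x) - v)"
      using \<open>c > 0\<close> by (simp add: zero_le_mult_iff)
  qed
  moreover have "x + c *\<^sub>R ((1 / c) *\<^sub>R (w - x)) = w" using \<open>c > 0\<close> by simp
  ultimately show thesis by (rule that)
qed

text \<open>Nonexpansiveness of the resolvent, phrased on graph points so that no inverse has to be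
  formed; monotonicity followed by Cauchy-Schwarz.\<close>

lemma resolvent_expansive:
  assumes mono: "monotone_op T" and "c > 0" and u: "u \<in> T x" "v \<in> T y"
  shows "norm (x - y) \<le> norm ((x + c *\<^sub>R u) - (y + c *\<^sub>R v))"
proof -
  have "(norm (x - y))\<^sup>2 \<le> (x - y) \<bullet> (x - y) + c * ((x - y) \<bullet> (u - v))"
    using monotone_opD[OF mono u] \<open>c > 0\<close> by (simp add: power2_norm_eq_inner)
  also have "\<dots> = (x - y) \<bullet> ((x + c *\<^sub>R u) - (y + c *\<^sub>R v))"
    by (simp add: inner_diff_left inner_diff_right inner_add_right algebra_simps)
  also have "\<dots> \<le> norm (x - y) * norm ((x + c *\<^sub>R u) - (y + c *\<^sub>R v))"
    by (rule norm_cauchy_schwarz)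
  finally show ?thesis
    by (cases "x = y") (auto simp: power2_eq_square)
qed

text \<open>Justifies the \<open>the_elem\<close> in \<open>resolvent\<close>: \<open>minty\<close>
  gives existence and \<open>resolvent_expansive\<close> uniqueness.\<close>

lemma resolvent_scaled_mem:
  fixes T :: "'a::{real_inner,complete_space} \<Rightarrow> 'a set"
  assumes T: "maximally_monotone T" and "c > 0"
  shows "(1 / c) *\<^sub>R (w - resolvent (c *\<^sub>o T) w) \<in> T (resolvent (c *\<^sub>o T) w)"
proof -
  obtain x u where x: "u \<in> T x" "x + c *\<^sub>R u = w" using minty[OF assms] .
  have iff: "y \<in> op_inverse (single_op id +\<^sub>o (c *\<^sub>o T)) w \<longleftrightarrow> (\<exists>v\<in>T y. w = y + c *\<^sub>R v)" for y
    by (auto simp: op_inverse_def op_plus_def op_scale_def single_op_def set_plus_def)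
  have "y = x" if "v \<in> T y" "w = y + c *\<^sub>R v" for y v
    using resolvent_expansive[OF _ \<open>c > 0\<close> that(1) x(1)] T x(2) that(2)
    by (simp add: maximally_monotone_def)
  then have "op_inverse (single_op id +\<^sub>o (c *\<^sub>o T)) w = {x}"
    using x iff by blast
  then have "resolvent (c *\<^sub>o T) w = x" by (simp add: resolvent_def)
  moreover have "(1 / c) *\<^sub>R (w - x) = u" using x(2)[symmetric] \<open>c > 0\<close> by simp
  ultimately show ?thesis using x(1) by simp
qed

text \<open>For \<open>(z, w)\<close> related to the graph of the sum, solve
  \<open>u + t (b + D u) = z + t w\<close> with \<open>b\<close> in \<open>M u\<close> by a fixed
  point of the resolvent of \<open>t M\<close>. Then \<open>z - u\<close> is \<open>t\<close> times
  \<open>e = b + D u - w\<close>, while relatedness makes its inner product with \<open>- e\<close>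
  nonnegative; hence \<open>e = 0\<close>.\<close>

lemma maximally_monotone_plus_lipschitz:
  fixes M :: "'a::{real_inner,complete_space} \<Rightarrow> 'a set"
  assumes M: "maximally_monotone M" and D: "monotone_op (single_op D)" "L-lipschitz_on UNIV D"
  shows "maximally_monotone (M +\<^sub>o single_op D)"
proof -
  have iff: "w \<in> (M +\<^sub>o single_op D) x \<longleftrightarrow> w - D x \<in> M x" for w x
    by (force simp: op_plus_def single_op_def set_plus_def)
  have monoM: "monotone_op M" using M by (simp add: maximally_monotone_def)
  have mono: "0 \<le> (x - y) \<bullet> (u - v)" if "u - D x \<in> M x" "v - D y \<in> M y" for x y u v
    using monotone_opD[OF monoM that] monotone_single_opD[OF D(1), of x y]
    by (simp add: inner_diff_right)
  have "w \<in> (M +\<^sub>o single_op D) z"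
    if rel: "\<And>y v. v - D y \<in> M y \<Longrightarrow> 0 \<le> (z - y) \<bullet> (w - v)" for z w
  proof -
    \<comment> \<open>The \<open>+ 1\<close> keeps the denominator positive for
      \<open>L = 0\<close>; the contraction constant becomes \<open>1/2\<close>.\<close>
    define t where "t = 1 / (2 * (L + 1))"
    have "L \<ge> 0" using D(2) by (rule lipschitz_on_nonneg)
    then have t: "t > 0" "t * L \<le> 1/2" by (auto simp: t_def field_simps)
    \<comment> \<open>A fixed point of the contraction \<open>J\<close> is related to \<open>z\<close> in a way that forces it to equal \<open>z\<close>.\<close>
    define p where "p u = z + t *\<^sub>R w - t *\<^sub>R D u" for u
    have "\<exists>x b. b \<in> M x \<and> x + t *\<^sub>R b = p u" for u
      using minty[OF M t(1)] by metis
    then obtain J b where J: "\<And>u. b u \<in> M (J u)" "\<And>u. J u + t *\<^sub>R b u = p u" by metis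
    have "dist (J u) (J v) \<le> (1/2) * dist u v" for u v
    proof -
      have "norm (J u - J v) \<le> norm (p u - p v)"
        using resolvent_expansive[OF monoM t(1) J(1)[of u] J(1)[of v]] by (simp only: J(2))
      also have "\<dots> = t * norm (D v - D u)"
        using t(1) by (simp add: p_def flip: scaleR_diff_right)
      also have "\<dots> \<le> t * (L * norm (v - u))"
        using lipschitz_onD[OF D(2), of v u] t(1) by (simp add: dist_norm)
      also have "\<dots> \<le> (1/2) * norm (v - u)"
        using mult_right_mono[OF t(2), of "norm (v - u)"] by (simp add: mult.assoc)
      finally show ?thesis by (simp add: dist_norm norm_minus_commute)
    qed
    then obtain u where "J u = u"
      using banach_fix_type[of "1/2" J] by auto
    then have bu: "b u \<in> M u" "u + t *\<^sub>R (b u + D u) = z + t *\<^sub>R w"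
      using J[of u] by (auto simp: p_def algebra_simps)
    then have rel': "0 \<le> (z - u) \<bullet> (w - (b u + D u))" by (intro rel) simp
    define e where "e = b u + D u - w"
    have "z - u = (z + t *\<^sub>R w) - (u + t *\<^sub>R w)" by simp
    also have "\<dots> = t *\<^sub>R e" unfolding bu(2)[symmetric] e_def by (simp add: algebra_simps)
    finally have zu: "z - u = t *\<^sub>R e" .
    moreover have "w - (b u + D u) = - e" by (simp add: e_def)
    ultimately have "e \<bullet> e \<le> 0" using rel' t(1) by (simp add: mult_le_0_iff)
    then have "e = 0" by (metis inner_gt_zero_iff leD)
    then have "u = z" "b u = w - D z" using zu by (auto simp: e_def algebra_simps)
    then show ?thesis using bu(1) by (simp add: iff)
  qed
  then show ?thesis
    using mono unfolding maximally_monotone_iff iff monotone_op_def op_graph_def by blast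
qed

subsection \<open>Weak cluster points and averages\<close>

text \<open>This replaces weak compactness. The minimal squared norms over \<open>K n\<close>
  increase to a finite limit, so by the parallelogram law points of almost minimal norm form a
  Cauchy sequence; its limit lies in every \<open>K n\<close>.\<close>

lemma nested_closed_convex_Inter_nonempty:
  fixes K :: "nat \<Rightarrow> 'a::{real_inner,complete_space} set"
  assumes K: "\<And>n. closed (K n)" "\<And>n. convex (K n)" "\<And>n. K n \<noteq> {}"
    and dec: "decseq K" and bdd: "bounded (K 0)"
  obtains q where "\<And>n. q \<in> K n"
proof -
  define e where "e n = Inf ((\<lambda>x. (norm x)\<^sup>2) ` K n)" for n
  have bb: "bdd_below ((\<lambda>x. (norm x)\<^sup>2) ` K n)" for n
    by (auto intro!: bdd_belowI[of _ 0])
  have sub: "K n \<subseteq> K m" if "m \<le> n" for m n using dec that by (auto simp: decseq_def)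
  have e_le: "e n \<le> (norm x)\<^sup>2" if "x \<in> K n" for x n
    unfolding e_def using bb that by (auto intro: cInf_lower)
  have "incseq e"
    unfolding incseq_def e_def using K(3) bb sub by (intro allI impI cInf_superset_mono image_mono) auto
  obtain R where R: "\<And>x. x \<in> K 0 \<Longrightarrow> norm x \<le> R" using bdd by (auto simp: bounded_iff)
  have e_R: "e n \<le> R\<^sup>2" for n
  proof -
    obtain x where "x \<in> K n" using K(3) by blast
    then have "norm x \<le> R" using sub[of 0 n] R by auto
    then show ?thesis using e_le[OF \<open>x \<in> K n\<close>] power_mono[of "norm x" R 2] by simp
  qed
  then obtain l where l: "e \<longlonglongrightarrow> l" "\<And>n. e n \<le> l"
    using incseq_convergent[OF \<open>incseq e\<close>] by metis
  have "\<exists>x. x \<in> K n \<and> (norm x)\<^sup>2 < e n + inverse (real (Suc n))" for n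
    using cInf_lessD[of "(\<lambda>x. (norm x)\<^sup>2) ` K n" "e n + inverse (real (Suc n))"] K(3)
    unfolding e_def by auto
  then obtain x where x: "\<And>n. x n \<in> K n" "\<And>n. (norm (x n))\<^sup>2 < e n + inverse (real (Suc n))"
    by metis
  have "(norm (x m - x n))\<^sup>2 \<le> 2 * (l - e m) + 4 * inverse (real (Suc m))" if "m \<le> n" for m n
  proof -
    have "(1/2) *\<^sub>R x m + (1/2) *\<^sub>R x n \<in> K m"
      using x(1) sub[OF that] by (intro convexD[OF K(2)]) auto
    from e_le[OF this] have "4 * e m \<le> 4 * (norm ((1/2) *\<^sub>R x m + (1/2) *\<^sub>R x n))\<^sup>2" by simp
    moreover have "inverse (real (Suc n)) \<le> inverse (real (Suc m))"
      using that by (simp add: field_simps)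
    then have "(norm (x n))\<^sup>2 \<le> l + inverse (real (Suc m))"
      using x(2)[of n] l(2)[of n] by linarith
    ultimately show ?thesis
      using norm_diff_square_midpoint[of "x m" "x n"] x(2)[of m] by argo
  qed
  moreover have "(\<lambda>m. 2 * (l - e m) + 4 * inverse (real (Suc m))) \<longlonglongrightarrow> 2 * (l - l) + 4 * 0"
    by (intro tendsto_intros l LIMSEQ_inverse_real_of_nat)
  then have "(\<lambda>m. 2 * (l - e m) + 4 * inverse (real (Suc m))) \<longlonglongrightarrow> 0" by simp
  ultimately have "Cauchy x" by (rule Cauchy_if_dist_square_le)
  then obtain q where q: "x \<longlonglongrightarrow> q"
    using Cauchy_convergent convergent_def by blast
  have "q \<in> K n" for n
  proof (rule Lim_in_closed_set[OF K(1)])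
    show "\<forall>\<^sub>F k in sequentially. x k \<in> K n"
      using x(1) sub by (intro eventually_sequentiallyI[of n]) auto
  qed (use q in auto)
  then show thesis by (rule that)
qed

text \<open>The nested sets are the closed convex hulls of the tails: a closed half-space that
  contains a tail contains its closed hull.\<close>

lemma bounded_sequence_weak_cluster_point:
  fixes z :: "nat \<Rightarrow> 'a::{real_inner,complete_space}"
  assumes "bounded (range z)"
  obtains q where "\<And>h c. \<forall>\<^sub>F n in sequentially. z n \<bullet> h \<le> c \<Longrightarrow> q \<bullet> h \<le> c"
proof -
  define K where "K m = closure (convex hull (z ` {m..}))" for m
  obtain q where q: "\<And>n. q \<in> K n"
  proof (rule nested_closed_convex_Inter_nonempty[of K])
    show "decseq K"
      unfolding K_def by (intro decseq_SucI closure_mono hull_mono image_mono) auto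
    have "bounded (z ` {0..})" using assms by (rule bounded_subset) auto
    then show "bounded (K 0)" unfolding K_def
      by (intro bounded_closure bounded_convex_hull)
  qed (auto simp: K_def intro: convex_closure)
  show thesis
  proof
    fix h c assume "\<forall>\<^sub>F n in sequentially. z n \<bullet> h \<le> c"
    then obtain N where "z ` {N..} \<subseteq> {x. h \<bullet> x \<le> c}"
      by (auto simp: eventually_sequentially inner_commute[of h])
    then have "K N \<subseteq> {x. h \<bullet> x \<le> c}"
      unfolding K_def
      by (intro closure_minimal hull_minimal convex_halfspace_le closed_halfspace_le)
    then show "q \<bullet> h \<le> c" using q[of N] by (auto simp: inner_commute)
  qed
qed

text \<open>Opial's argument. Two cluster points \<open>q\<close>, \<open>q'\<close> lie in
  \<open>S\<close>, so the products with \<open>q - q'\<close> converge, which forces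
  \<open>q = q'\<close>. If weak convergence to the only cluster point failed, a subsequence would
  stay outside some half-space around it and have a different cluster point.\<close>

lemma weak_convergence_if_cluster_points:
  fixes z :: "nat \<Rightarrow> 'a::{real_inner,complete_space}"
  assumes bdd: "bounded (range z)"
    and conv: "\<And>u v. u \<in> S \<Longrightarrow> v \<in> S \<Longrightarrow> convergent (\<lambda>n. z n \<bullet> (u - v))"
    and cluster: "\<And>q r. strict_mono (r :: nat \<Rightarrow> nat) \<Longrightarrow>
      (\<And>h c. \<forall>\<^sub>F n in sequentially. z (r n) \<bullet> h \<le> c \<Longrightarrow> q \<bullet> h \<le> c) \<Longrightarrow> q \<in> S"
  shows "\<exists>l\<in>S. weakly_converges z l"
proof -
  have cluster_ex: "\<exists>q. \<forall>h c. (\<forall>\<^sub>F n in sequentially. z (r n) \<bullet> h \<le> c) \<longrightarrow> q \<bullet> h \<le> c" for r :: "nat \<Rightarrow> nat"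
  proof -
    have "bounded (range (\<lambda>n. z (r n)))" using bdd by (rule bounded_subset) auto
    then show ?thesis using bounded_sequence_weak_cluster_point by metis
  qed
  have inner_le: "q \<bullet> h \<le> l" if "(\<lambda>n. z n \<bullet> h) \<longlonglongrightarrow> l" "strict_mono (r :: nat \<Rightarrow> nat)"
    "\<And>h c. \<forall>\<^sub>F n in sequentially. z (r n) \<bullet> h \<le> c \<Longrightarrow> q \<bullet> h \<le> c" for q r h l
  proof (rule field_le_epsilon)
    fix e :: real assume "e > 0"
    have "(\<lambda>n. z (r n) \<bullet> h) \<longlonglongrightarrow> l"
      using LIMSEQ_subseq_LIMSEQ[OF that(1,2)] by (simp add: o_def)
    then have "\<forall>\<^sub>F n in sequentially. z (r n) \<bullet> h < l + e" using \<open>e > 0\<close> by (intro order_tendstoD) auto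
    then show "q \<bullet> h \<le> l + e" by (intro that(3)) (auto elim: eventually_mono)
  qed
  have unique: "q = q'"
    if r: "strict_mono (r :: nat \<Rightarrow> nat)" "\<And>h c. \<forall>\<^sub>F n in sequentially. z (r n) \<bullet> h \<le> c \<Longrightarrow> q \<bullet> h \<le> c"
      and r': "strict_mono (r' :: nat \<Rightarrow> nat)" "\<And>h c. \<forall>\<^sub>F n in sequentially. z (r' n) \<bullet> h \<le> c \<Longrightarrow> q' \<bullet> h \<le> c"
    for q q' r r'
  proof -
    have S: "q \<in> S" "q' \<in> S" using cluster r r' by blast+
    obtain l where l: "(\<lambda>n. z n \<bullet> (q - q')) \<longlonglongrightarrow> l" using conv[OF S] by (auto simp: convergent_def)
    have l': "(\<lambda>n. z n \<bullet> (q' - q)) \<longlonglongrightarrow> - l"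
      using tendsto_minus[OF l] by (simp flip: inner_minus_right)
    have "q \<bullet> (q - q') \<le> l" using inner_le[OF l r] .
    moreover have "q' \<bullet> (q' - q) \<le> - l" using inner_le[OF l' r'] .
    ultimately have "(q - q') \<bullet> (q - q') \<le> 0"
      by (simp add: inner_diff_left inner_diff_right)
    then show ?thesis by (metis inner_gt_zero_iff leD right_minus_eq)
  qed
  obtain l where l: "\<And>h c. \<forall>\<^sub>F n in sequentially. z (id n) \<bullet> h \<le> c \<Longrightarrow> l \<bullet> h \<le> c"
    using cluster_ex[of id] by blast
  have upper: "\<forall>\<^sub>F n in sequentially. z n \<bullet> h < l \<bullet> h + e" if "e > 0" for h e
  proof (rule ccontr)
    assume "\<not> ?thesis"
    then have "\<exists>\<^sub>\<infinity>n. l \<bullet> h + e \<le> z n \<bullet> h"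
      by (simp add: not_eventually not_less cofinite_eq_sequentially)
    then obtain r :: "nat \<Rightarrow> nat" where r: "strict_mono r" "\<And>n. l \<bullet> h + e \<le> z (r n) \<bullet> h"
      using infinite_enumerate[of "{n. l \<bullet> h + e \<le> z n \<bullet> h}"] by (auto simp: INFM_iff_infinite)
    obtain q where q: "\<And>h c. \<forall>\<^sub>F n in sequentially. z (r n) \<bullet> h \<le> c \<Longrightarrow> q \<bullet> h \<le> c"
      using cluster_ex[of r] by blast
    have "q = l" using unique[OF r(1) q strict_mono_id l] .
    moreover have "q \<bullet> (- h) \<le> - (l \<bullet> h + e)" using r(2) by (intro q always_eventually allI) (simp add: algebra_simps)
    ultimately show False using \<open>e > 0\<close> by simp
  qed
  have "weakly_converges z l"
    unfolding weakly_converges_def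
  proof (intro allI order_tendstoI)
    fix h a assume "l \<bullet> h < a"
    then show "\<forall>\<^sub>F n in sequentially. z n \<bullet> h < a" using upper[of "a - l \<bullet> h" h] by simp
  next
    fix h a assume "a < l \<bullet> h"
    then show "\<forall>\<^sub>F n in sequentially. a < z n \<bullet> h" using upper[of "l \<bullet> h - a" "- h"] by simp
  qed
  moreover have "l \<in> S" using cluster[OF strict_mono_id l] .
  ultimately show ?thesis by blast
qed

text \<open>From \<open>N\<close> on, subtracting the partial sums of \<open>s\<close> from
  \<open>\<Phi>\<close> leaves a decreasing sequence that is bounded below.\<close>

lemma quasi_decreasing_convergence:
  fixes \<Phi> d s :: "nat \<Rightarrow> real"
  assumes step: "\<And>n. n \<ge> N \<Longrightarrow> \<Phi> (Suc n) + d n \<le> \<Phi> n + s n"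
    and nonneg: "\<And>n. \<Phi> n \<ge> 0" "\<And>n. d n \<ge> 0" "\<And>n. s n \<ge> 0" and s: "summable s"
  shows "convergent \<Phi>" "summable d"
proof -
  have part: "(\<Sum>k<n. s (k + N)) \<le> suminf (\<lambda>k. s (k + N))" for n
    using s nonneg(3) by (intro sum_le_suminf) (auto simp: summable_iff_shift)
  have acc: "\<Phi> (n + N) + (\<Sum>k<n. d (k + N)) \<le> \<Phi> N + (\<Sum>k<n. s (k + N))" for n
  proof (induction n)
    case (Suc n)
    then show ?case using step[of "n + N"] by simp
  qed simp
  have "summable (\<lambda>k. d (k + N))"
  proof (rule bounded_imp_summable)
    fix n
    show "(\<Sum>k\<le>n. d (k + N)) \<le> \<Phi> N + suminf (\<lambda>k. s (k + N))"
      using acc[of "Suc n"] part[of "Suc n"] nonneg(1)[of "Suc n + N"]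
      by (simp add: lessThan_Suc_atMost)
  qed (rule nonneg)
  then show "summable d" by (simp add: summable_iff_shift)
  define \<Psi> where "\<Psi> n = \<Phi> (n + N) - (\<Sum>k<n. s (k + N))" for n
  have "decseq \<Psi>"
  proof (rule decseq_SucI)
    fix n show "\<Psi> (Suc n) \<le> \<Psi> n"
      using step[of "n + N"] nonneg(2)[of "n + N"] by (simp add: \<Psi>_def)
  qed
  moreover have "- suminf (\<lambda>k. s (k + N)) \<le> \<Psi> n" for n
    using nonneg(1)[of "n + N"] part[of n] by (simp add: \<Psi>_def)
  ultimately obtain l where "\<Psi> \<longlonglongrightarrow> l" using decseq_convergent by metis
  moreover have "(\<lambda>n. \<Sum>k<n. s (k + N)) \<longlonglongrightarrow> suminf (\<lambda>k. s (k + N))"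
    using s by (intro summable_LIMSEQ) (simp add: summable_iff_shift)
  ultimately have "(\<lambda>n. \<Psi> n + (\<Sum>k<n. s (k + N))) \<longlonglongrightarrow> l + suminf (\<lambda>k. s (k + N))"
    by (rule tendsto_add)
  then have "(\<lambda>n. \<Phi> (n + N)) \<longlonglongrightarrow> l + suminf (\<lambda>k. s (k + N))" by (simp add: \<Psi>_def)
  then show "convergent \<Phi>" using LIMSEQ_offset convergentI by blast
qed

text \<open>A weighted Cesaro mean: the terms before \<open>N\<close> contribute at most a constant
  \<open>K\<close>, which the diverging total weight makes negligible.\<close>

lemma weighted_average_tendsto:
  fixes a w :: "nat \<Rightarrow> real"
  assumes a: "a \<longlonglongrightarrow> l" and w: "\<And>n. w n > 0"
    and top: "filterlim (\<lambda>n. \<Sum>k\<le>n. w k) at_top sequentially"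
  shows "(\<lambda>n. (\<Sum>k\<le>n. w k * a k) / (\<Sum>k\<le>n. w k)) \<longlonglongrightarrow> l"
proof (rule LIMSEQ_I)
  fix e :: real assume "e > 0"
  then obtain N where N: "\<And>k. k \<ge> N \<Longrightarrow> \<bar>a k - l\<bar> < e/2"
    using LIMSEQ_D[OF a, of "e/2"] by auto
  define W where "W n = (\<Sum>k\<le>n. w k)" for n
  have W_pos: "W n > 0" for n unfolding W_def using w by (intro sum_pos) auto
  define K where "K = (\<Sum>k<N. w k * \<bar>a k - l\<bar>)"
  have bound: "(\<Sum>k\<le>n. w k * \<bar>a k - l\<bar>) \<le> K + e/2 * W n" for n
  proof -
    have "w k * \<bar>a k - l\<bar> \<le> (if k < N then w k * \<bar>a k - l\<bar> else 0) + e/2 * w k" for k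
      using w[of k] N[of k] mult_left_mono[of "\<bar>a k - l\<bar>" "e/2" "w k"] \<open>e > 0\<close>
      by (auto simp: mult.commute)
    then have "(\<Sum>k\<le>n. w k * \<bar>a k - l\<bar>)
        \<le> (\<Sum>k\<le>n. (if k < N then w k * \<bar>a k - l\<bar> else 0) + e/2 * w k)" by (rule sum_mono)
    also have "\<dots> = (\<Sum>k\<in>{..n} \<inter> {..<N}. w k * \<bar>a k - l\<bar>) + e/2 * W n"
      by (simp add: sum.distrib sum_distrib_left W_def flip: sum.inter_restrict)
        (simp add: sum.inter_restrict lessThan_def)
    also have "(\<Sum>k\<in>{..n} \<inter> {..<N}. w k * \<bar>a k - l\<bar>) \<le> K"
      unfolding K_def using w by (intro sum_mono2) (auto intro!: mult_nonneg_nonneg intro: less_imp_le)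
    finally show ?thesis by simp
  qed
  have "\<forall>\<^sub>F n in sequentially. W n > 2 * K / e"
    using top unfolding W_def filterlim_at_top_dense by blast
  then obtain M where M: "\<And>n. n \<ge> M \<Longrightarrow> W n > 2 * K / e" by (auto simp: eventually_sequentially)
  show "\<exists>M. \<forall>n\<ge>M. norm ((\<Sum>k\<le>n. w k * a k) / (\<Sum>k\<le>n. w k) - l) < e"
  proof (intro exI[of _ M] allI impI)
    fix n assume "n \<ge> M"
    have "(\<Sum>k\<le>n. w k * a k) / W n - l = (\<Sum>k\<le>n. w k * (a k - l)) / W n"
      using W_pos[of n]
      by (simp add: field_simps sum_subtractf W_def sum_distrib_left sum_distrib_right)
    also have "\<bar>\<dots>\<bar> \<le> (\<Sum>k\<le>n. w k * \<bar>a k - l\<bar>) / W n"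
      using W_pos[of n] sum_abs[of "\<lambda>k. w k * (a k - l)" "{..n}"] w
      by (simp add: abs_mult divide_right_mono less_imp_le abs_of_pos)
    also have "\<dots> \<le> (K + e/2 * W n) / W n"
      using bound[of n] W_pos[of n] by (intro divide_right_mono) auto
    also have "\<dots> < e" using M[OF \<open>n \<ge> M\<close>] \<open>e > 0\<close> W_pos[of n] by (simp add: field_simps)
    finally show "norm ((\<Sum>k\<le>n. w k * a k) / (\<Sum>k\<le>n. w k) - l) < e" by (simp add: W_def)
  qed
qed

subsection \<open>The forward-backward-forward iteration with past gradients\<close>

text \<open>Here \<open>x\<close>, \<open>x'\<close> are consecutive iterates, and \<open>y\<close>,
  \<open>y'\<close> the current and previous resolvent points. In the three-point identity for
  \<open>x' - u\<close>, the term \<open>- (norm (x - y))\<^sup>2\<close> is traded by the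
  parallelogram law for \<open>(norm (x - y'))\<^sup>2\<close> minus half of
  \<open>(norm (y - y'))\<^sup>2\<close>. The coefficient on the left is positive for
  \<open>L\<close> between \<open>0\<close> and \<open>1/2\<close>.\<close>

lemma forward_backward_forward_energy:
  fixes x x' y y' u :: "'a::real_inner"
  assumes "norm (x' - y) \<le> L * norm (y - y')"
  shows "(norm (x' - u))\<^sup>2 + (norm (x' - y))\<^sup>2 + (1/2 - 2 * L\<^sup>2) * (norm (y - y'))\<^sup>2
    \<le> (norm (x - u))\<^sup>2 + (norm (x - y'))\<^sup>2 - 2 * ((x - x') \<bullet> (y - u))"
proof -
  have "(norm (x' - u))\<^sup>2
      = (norm (x - u))\<^sup>2 + (norm (x' - y))\<^sup>2 - (norm (x - y))\<^sup>2 - 2 * ((x - x') \<bullet> (y - u))"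
    by (simp add: power2_norm_eq_inner inner_diff_left inner_diff_right inner_commute)
  moreover have "(norm (x' - y))\<^sup>2 \<le> L\<^sup>2 * (norm (y - y'))\<^sup>2"
    using power_mono[OF assms, of 2] by (simp add: power_mult_distrib)
  moreover have "(norm (y - y'))\<^sup>2 \<le> 2 * (norm (x - y))\<^sup>2 + 2 * (norm (x - y'))\<^sup>2"
    using norm_diff_square_midpoint[of "x - y'" "x - y"] by simp
  ultimately show ?thesis by (simp add: left_diff_distrib)
qed

text \<open>\<open>A\<close> and \<open>D\<close> are handled by monotonicity between
  \<open>u\<close> and \<open>y\<close>. The penalty term, with \<open>g\<close> in the role of
  \<open>B y\<close>, is exchanged for \<open>q\<close> at the cost of the gap bounded by
  \<open>s\<close>.\<close>

lemma forward_backward_forward_step: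
  assumes A: "monotone_op A" "a \<in> A u" "b \<in> A y" and D: "monotone_op (single_op D)"
    and x': "x - x' = t *\<^sub>R b + t *\<^sub>R D y + (t * \<beta>) *\<^sub>R g" and "t > 0"
    and s: "t * \<beta> * (u \<bullet> g + y \<bullet> q - y \<bullet> g - u \<bullet> q) \<le> s"
  shows "t * ((y - u) \<bullet> (a + D u + \<beta> *\<^sub>R q)) - s \<le> (x - x') \<bullet> (y - u)"
proof -
  have "0 \<le> t * ((y - u) \<bullet> (b - a)) + t * ((y - u) \<bullet> (D y - D u))"
    using monotone_opD[OF A(1,3,2)] monotone_single_opD[OF D, of y u] \<open>t > 0\<close> by simp
  then show ?thesis using s unfolding x'
    by (simp add: inner_add_left inner_add_right inner_diff_left inner_diff_right
        inner_commute[of _ y] inner_commute[of _ u] algebra_simps)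
qed

text \<open>For \<open>q\<close> normal to \<open>C\<close> at \<open>u\<close>, the support
  function is attained at \<open>u\<close>; the Fitzpatrick supremum is bounded below by its term at
  \<open>(y, B y)\<close>.\<close>

lemma fitzpatrick_gap_ge:
  assumes "u \<in> C" "q \<in> normal_cone C u"
  shows "ereal (u \<bullet> B y + y \<bullet> q - y \<bullet> B y - u \<bullet> q)
    \<le> (SUP u\<in>C. fitzpatrick (single_op B) u q) - support_fun C q"
proof -
  have "support_fun C q = ereal (u \<bullet> q)"
    unfolding support_fun_def
  proof (rule antisym)
    show "(SUP y\<in>C. ereal (y \<bullet> q)) \<le> ereal (u \<bullet> q)"
      using assms by (intro SUP_least) (auto simp: normal_cone_def inner_diff_left)
    show "ereal (u \<bullet> q) \<le> (SUP y\<in>C. ereal (y \<bullet> q))" using assms(1) by (rule SUP_upper)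
  qed
  moreover have "ereal (u \<bullet> B y + y \<bullet> q - y \<bullet> B y) \<le> fitzpatrick (single_op B) u q"
    unfolding fitzpatrick_def
    by (rule SUP_upper2[of "(y, B y)"]) (auto simp: op_graph_def single_op_def)
  then have "ereal (u \<bullet> B y + y \<bullet> q - y \<bullet> B y) \<le> (SUP u\<in>C. fitzpatrick (single_op B) u q)"
    using assms(1) by (rule order_trans[OF _ SUP_upper])
  then have "ereal (u \<bullet> B y + y \<bullet> q - y \<bullet> B y) - ereal (u \<bullet> q)
      \<le> (SUP u\<in>C. fitzpatrick (single_op B) u q) - ereal (u \<bullet> q)"
    by (rule ereal_minus_mono) simp
  ultimately show ?thesis by simp
qed

lemma ereal_suminf_finite_imp_summable:
  fixes f :: "nat \<Rightarrow> ereal"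
  assumes "\<And>n. 0 \<le> f n" "suminf f < \<infinity>"
  obtains s where "\<And>n. f n = ereal (s n)" "\<And>n. 0 \<le> s n" "summable s"
proof -
  have "suminf f \<noteq> \<infinity>" using assms(2) by simp
  then obtain s where s: "f = (\<lambda>n. ereal (s n))" using suminf_PInfty_fun[of f, OF assms(1)] by blast
  have nonneg: "0 \<le> s n" for n using assms(1)[of n] by (simp add: s)
  have "summable s" using \<open>suminf f \<noteq> \<infinity>\<close> nonneg by (intro summable_ereal) (auto simp: s)
  with s nonneg show thesis by (intro that) auto
qed

text \<open>Here \<open>t\<close> may change sign, so telescoping yields only an upper bound on its
  partial sums. The uncontrolled terms before \<open>N\<close> stay in the constant.\<close>

lemma quasi_decreasing_partial_sums:
  fixes \<Phi> t s :: "nat \<Rightarrow> real"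
  assumes step: "\<And>n. n \<ge> N \<Longrightarrow> \<Phi> (Suc n) + t n \<le> \<Phi> n + s n"
    and nonneg: "\<And>n. \<Phi> n \<ge> 0" "\<And>n. s n \<ge> 0" and s: "summable s" and "n \<ge> N"
  shows "(\<Sum>k<n. t k) \<le> (\<Sum>k<N. t k) + \<Phi> N + suminf s"
proof -
  have "(\<Sum>k<n. t k) + \<Phi> n \<le> (\<Sum>k<N. t k) + \<Phi> N + (\<Sum>k<n. s k)"
    using \<open>n \<ge> N\<close>
  proof (induction n rule: nat_induct_at_least)
    case base
    then show ?case using nonneg(2) by (simp add: sum_nonneg)
  next
    case (Suc n)
    then show ?case using step[of n] by simp
  qed
  moreover have "(\<Sum>k<n. s k) \<le> suminf s" using s nonneg(2) by (intro sum_le_suminf) auto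
  ultimately show ?thesis using nonneg(1)[of n] by linarith
qed

lemma partial_sums_at_top:
  fixes w :: "nat \<Rightarrow> real"
  assumes pos: "\<And>n. 0 \<le> w n" and "\<not> summable w"
  shows "filterlim (\<lambda>n. \<Sum>k\<le>n. w k) at_top sequentially"
  unfolding filterlim_at_top
proof
  fix Z
  obtain N where "Z < (\<Sum>k\<le>N. w k)"
    using bounded_imp_summable[of w Z] assms by (meson not_le)
  moreover have "(\<Sum>k\<le>N. w k) \<le> (\<Sum>k\<le>n. w k)" if "n \<ge> N" for n
    using pos that by (intro sum_mono2) auto
  ultimately show "\<forall>\<^sub>F n in sequentially. Z \<le> (\<Sum>k\<le>n. w k)"
    by (intro eventually_sequentiallyI[of N]) (metis less_le_trans less_imp_le)
qed

theorem theorem5: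
  fixes A :: "'a::{real_inner, complete_space} \<Rightarrow> 'a set"
    and D B :: "'a \<Rightarrow> 'a"
    and \<eta> \<mu> :: real
    and C :: "'a set"
    and lam \<beta> \<tau> :: "nat \<Rightarrow> real"
    and x z :: "nat \<Rightarrow> 'a"
    and y :: "int \<Rightarrow> 'a"
  assumes A: "maximally_monotone A"
    and D: "monotone_op (single_op D)" "(inverse \<eta>)-lipschitz_on UNIV D" "\<eta> > 0"
    and B: "monotone_op (single_op B)" "(inverse \<mu>)-lipschitz_on UNIV B" "\<mu> > 0"
    and C: "C = zer (single_op B)" "C \<noteq> {}"
    and pos: "\<And>n. lam n > 0" "\<And>n. \<beta> n > 0"
    and y_init: "y (-1) = x 0"
    and y_step: "\<And>n. y (int n) = resolvent (lam n *\<^sub>o A)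
          (x n - lam n *\<^sub>R D (y (int n - 1)) - (lam n * \<beta> n) *\<^sub>R B (y (int n - 1)))"
    and x_step: "\<And>n. x (Suc n) =
          (lam n * \<beta> n) *\<^sub>R (B (y (int n - 1)) - B (y (int n)))
          + lam n *\<^sub>R (D (y (int n - 1)) - D (y (int n))) + y (int n)"
    and tau: "\<And>n. \<tau> n = (\<Sum>k\<le>n. lam k)"
    and z: "\<And>n. z n = (1 / \<tau> n) *\<^sub>R (\<Sum>k\<le>n. lam k *\<^sub>R x k)"
    and i: "maximally_monotone (A +\<^sub>o normal_cone C)"
           "zer (A +\<^sub>o single_op D +\<^sub>o normal_cone C) \<noteq> {}"
    and ii: "\<And>p. p \<in> op_ran (normal_cone C) \<Longrightarrow>
          (\<Sum>n. ereal (lam n * \<beta> n) *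
             ((SUP u\<in>C. fitzpatrick (single_op B) u ((1 / \<beta> n) *\<^sub>R p))
               - support_fun C ((1 / \<beta> n) *\<^sub>R p))) < \<infinity>"
    and iii: "summable (\<lambda>n. \<bar>lam n\<bar>\<^sup>2)" "\<not> summable (\<lambda>n. \<bar>lam n\<bar>)"
    and step_size: "limsup (\<lambda>n. ereal (lam n * \<beta> n / \<mu> + lam n / \<eta>)) < ereal (1 / 2)"
  shows "\<exists>l \<in> zer (A +\<^sub>o single_op D +\<^sub>o normal_cone C). weakly_converges z l"
proof -
  define T where "T = A +\<^sub>o single_op D +\<^sub>o normal_cone C"
  have T_max: "maximally_monotone T"
  proof -
    \<comment> \<open>Reordered so that \<open>D\<close> perturbs the operator whose maximality is
      assumed.\<close>
    have "T = A +\<^sub>o normal_cone C +\<^sub>o single_op D"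
      by (rule ext) (simp add: T_def op_plus_def ac_simps)
    then show ?thesis using maximally_monotone_plus_lipschitz[OF i(1) D(1,2)] by simp
  qed

  \<comment> \<open>The iteration as an inclusion with a Lipschitz correction\<close>
  have monoA: "monotone_op A" using A by (simp add: maximally_monotone_def)
  \<comment> \<open>Index shift: \<open>Y (Suc n)\<close> is the paper's \<open>y\<^sub>n\<close>, and \<open>Y 0\<close> its \<open>y\<^sub>-\<^sub>1\<close>.\<close>
  define Y where "Y n = y (int n - 1)" for n
  have Y_Suc: "y (int n) = Y (Suc n)" for n by (simp add: Y_def)
  \<comment> \<open>Resolvent input minus output, divided by the step length: the element of
    \<open>A\<close> selected by the implicit step.\<close>
  define b where "b n = (1 / lam n) *\<^sub>R
    (x n - lam n *\<^sub>R D (Y n) - (lam n * \<beta> n) *\<^sub>R B (Y n) - Y (Suc n))" for n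
  have b_mem: "b n \<in> A (Y (Suc n))" for n
    using resolvent_scaled_mem[OF A pos(1)] y_step[of n] unfolding b_def Y_Suc Y_def[symmetric]
    by metis
  have x_diff: "x n - x (Suc n)
      = lam n *\<^sub>R b n + lam n *\<^sub>R D (Y (Suc n)) + (lam n * \<beta> n) *\<^sub>R B (Y (Suc n))" for n
    using x_step[of n] pos(1)[of n]
    by (simp add: b_def Y_Suc flip: Y_def) (simp add: algebra_simps)
  \<comment> \<open>A Lipschitz constant of the combined forward operator, step lengths
    included.\<close>
  define \<rho> where "\<rho> n = lam n * \<beta> n / \<mu> + lam n / \<eta>" for n
  have lip: "norm (x (Suc n) - Y (Suc n)) \<le> \<rho> n * norm (Y (Suc n) - Y n)" for n
  proof -
    have "norm (x (Suc n) - Y (Suc n)) \<le> (lam n * \<beta> n) * norm (B (Y n) - B (Y (Suc n)))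
        + lam n * norm (D (Y n) - D (Y (Suc n)))"
      using x_step[of n] pos[of n] norm_triangle_ineq[of
          "(lam n * \<beta> n) *\<^sub>R (B (Y n) - B (Y (Suc n)))" "lam n *\<^sub>R (D (Y n) - D (Y (Suc n)))"]
      by (simp add: Y_Suc flip: Y_def)
    also have "\<dots> \<le> (lam n * \<beta> n) * (inverse \<mu> * norm (Y n - Y (Suc n)))
        + lam n * (inverse \<eta> * norm (Y n - Y (Suc n)))"
      using lipschitz_onD[OF B(2), of "Y n" "Y (Suc n)"] lipschitz_onD[OF D(2), of "Y n" "Y (Suc n)"]
        pos[of n] by (intro add_mono mult_left_mono) (auto simp: dist_norm)
    also have "\<dots> = \<rho> n * norm (Y (Suc n) - Y n)"
      by (simp add: \<rho>_def norm_minus_commute field_simps)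
    finally show ?thesis .
  qed
  \<comment> \<open>A fixed bound strictly below \<open>1/2\<close> makes the coefficient
    \<open>c\<close> below positive and independent of \<open>n\<close>.\<close>
  obtain L where "limsup (\<lambda>n. ereal (\<rho> n)) < ereal L" "L < 1/2"
    using ereal_dense2[OF step_size] by (auto simp: \<rho>_def)
  then obtain N where N: "\<And>n. n \<ge> N \<Longrightarrow> \<rho> n < L"
    using Limsup_lessD[of sequentially "\<lambda>n. ereal (\<rho> n)" "ereal L"] by (auto simp: eventually_sequentially)
  have "\<rho> N > 0" using pos[of N] B(3) D(3) by (simp add: \<rho>_def add_pos_pos)
  then have "L > 0" using N[of N] by simp
  then have "L\<^sup>2 < (1/2)\<^sup>2" using \<open>L < 1/2\<close> by (intro power_strict_mono) auto
  define c where "c = 1/2 - 2 * L\<^sup>2"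
  have "c > 0" using \<open>L\<^sup>2 < (1/2)\<^sup>2\<close> by (simp add: c_def power2_eq_square)

  \<comment> \<open>The energy inequality\<close>
  define e where "e n = (norm (x n - Y n))\<^sup>2" for n
  define d where "d n = (norm (Y (Suc n) - Y n))\<^sup>2" for n
  have lipL: "norm (x (Suc n) - Y (Suc n)) \<le> L * norm (Y (Suc n) - Y n)" if "n \<ge> N" for n
    using lip[of n] N[OF that] mult_right_mono[of "\<rho> n" L "norm (Y (Suc n) - Y n)"] by simp
  have energy: "\<exists>s. summable s \<and> (\<forall>n. 0 \<le> s n) \<and> (\<forall>n\<ge>N.
      ((norm (x (Suc n) - u))\<^sup>2 + e (Suc n)) + (c * d n + 2 * (lam n * ((Y (Suc n) - u) \<bullet> w)))
      \<le> ((norm (x n - u))\<^sup>2 + e n) + s n)" if "w \<in> T u" for u w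
  proof -
    obtain a p where ap: "a \<in> A u" "p \<in> normal_cone C u" "w = a + D u + p"
      using \<open>w \<in> T u\<close> unfolding T_def op_plus_def single_op_def set_plus_def by blast
    then have "u \<in> C" by (auto simp: normal_cone_def split: if_splits)
    \<comment> \<open>Rescaling by \<open>\<beta> n\<close> keeps \<open>p\<close> in the cone and
      cancels the penalty factor in front of \<open>q n\<close>.\<close>
    define q where "q n = (1 / \<beta> n) *\<^sub>R p" for n
    define f where "f n = ereal (lam n * \<beta> n) *
             ((SUP u\<in>C. fitzpatrick (single_op B) u (q n)) - support_fun C (q n))" for n
    have q: "q n \<in> normal_cone C u" for n
      using ap(2) \<open>u \<in> C\<close> pos(2)[of n] by (auto simp: q_def normal_cone_def mult_nonneg_nonpos divide_le_0_iff)
    have f: "ereal (lam n * \<beta> n * (u \<bullet> B v + v \<bullet> q n - v \<bullet> B v - u \<bullet> q n)) \<le> f n" for n v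
      unfolding f_def times_ereal.simps(1)[symmetric] using pos[of n]
      by (intro ereal_mult_left_mono fitzpatrick_gap_ge \<open>u \<in> C\<close> q) auto
    \<comment> \<open>At \<open>v = u\<close> the lower bound for the gap vanishes.\<close>
    have "0 \<le> f n" for n using f[where v = u] by (simp add: zero_ereal_def)
    moreover have "suminf f < \<infinity>"
      using ii[of p] ap(2) by (auto simp: op_ran_def f_def[abs_def] q_def)
    ultimately obtain s where s: "\<And>n. f n = ereal (s n)" "\<And>n. 0 \<le> s n" "summable s"
      by (rule ereal_suminf_finite_imp_summable) blast
    have "lam n * ((Y (Suc n) - u) \<bullet> w) - s n \<le> (x n - x (Suc n)) \<bullet> (Y (Suc n) - u)" for n
      using forward_backward_forward_step[OF monoA ap(1) b_mem[of n] D(1) x_diff[of n] pos(1),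
          where q = "q n" and s = "s n"] f[of n "Y (Suc n)"] pos(2)[of n]
      by (simp add: s(1) q_def ap(3))
    then have "((norm (x (Suc n) - u))\<^sup>2 + e (Suc n)) + (c * d n + 2 * (lam n * ((Y (Suc n) - u) \<bullet> w)))
      \<le> ((norm (x n - u))\<^sup>2 + e n) + 2 * s n" if "n \<ge> N" for n
      using forward_backward_forward_energy[OF lipL[OF that], where x = "x n" and u = u]
      unfolding c_def d_def e_def by (smt (verit))
    then show ?thesis using s(2,3)
      by (intro exI[of _ "\<lambda>n. 2 * s n"]) (auto intro: summable_mult)
  qed

  \<comment> \<open>Convergence of distances to zeros, and summable residuals\<close>
  have limits: "convergent (\<lambda>n. (norm (x n - u))\<^sup>2 + e n)" "summable d" if "u \<in> zer T" for u
  proof -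
    obtain s where s: "summable s" "\<And>n. 0 \<le> s n" "\<And>n. n \<ge> N \<Longrightarrow>
      ((norm (x (Suc n) - u))\<^sup>2 + e (Suc n)) + c * d n \<le> ((norm (x n - u))\<^sup>2 + e n) + s n"
      using energy[of 0 u] \<open>u \<in> zer T\<close> by (auto simp: zer_def)
    have nonneg: "0 \<le> (norm (x n - u))\<^sup>2 + e n" "0 \<le> c * d n" for n
      using \<open>c > 0\<close> by (auto simp: e_def d_def)
    show "convergent (\<lambda>n. (norm (x n - u))\<^sup>2 + e n)"
      by (rule quasi_decreasing_convergence(1)[OF s(3) nonneg s(2,1)])
    have "summable (\<lambda>n. c * d n)"
      by (rule quasi_decreasing_convergence(2)[OF s(3) nonneg s(2,1)])
    then show "summable d" using summable_mult[of "\<lambda>n. c * d n" "1 / c"] \<open>c > 0\<close> by simp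
  qed
  obtain u\<^sub>0 where u\<^sub>0: "u\<^sub>0 \<in> zer T" using i(2) by (auto simp: T_def)
  have sum_d: "summable d" using limits(2)[OF u\<^sub>0] .
  have "e (Suc n) \<le> L\<^sup>2 * d n" if "n \<ge> N" for n
    using power_mono[OF lipL[OF that], of 2] by (simp add: e_def d_def power_mult_distrib)
  then have "summable (\<lambda>n. e (Suc n))"
    by (intro summable_comparison_test'[OF summable_mult[OF sum_d]]) (auto simp: e_def)
  then have sum_e: "summable e" by (simp add: summable_Suc_iff)
  \<comment> \<open>Controls the exchange of the resolvent point \<open>Y (Suc n)\<close> for
    \<open>x n\<close>, since the averages are formed from the latter.\<close>
  define f where "f n = (norm (x n - Y (Suc n)))\<^sup>2" for n
  have "f n \<le> 2 * e n + 2 * d n" for n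
    using norm_diff_square_midpoint[of "x n - Y n" "Y (Suc n) - Y n"] by (simp add: f_def e_def d_def)
  then have sum_f: "summable f"
    by (intro summable_comparison_test'[OF summable_add[OF summable_mult[OF sum_e] summable_mult[OF sum_d]]])
      (auto simp: f_def)
  have dist_conv: "convergent (\<lambda>n. (norm (x n - u))\<^sup>2)" if "u \<in> zer T" for u
    using convergent_diff[OF limits(1)[OF that]] summable_LIMSEQ_zero[OF sum_e] convergentI
    by fastforce

  \<comment> \<open>Boundedness and scalar limits of the averages\<close>
  have tau_pos: "\<tau> n > 0" for n unfolding tau using pos by (intro sum_pos) auto
  have tau_top: "filterlim (\<lambda>n. \<Sum>k\<le>n. lam k) at_top sequentially"
    using pos(1) iii(2) by (intro partial_sums_at_top) (auto intro: less_imp_le simp: abs_of_pos)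
  have z_inner: "z n \<bullet> h = (\<Sum>k\<le>n. lam k * (x k \<bullet> h)) / (\<Sum>k\<le>n. lam k)" for n h
    by (simp add: z tau inner_sum_left)
  have "bounded (range z)"
  proof -
    have "Bseq (\<lambda>n. (norm (x n - u\<^sub>0))\<^sup>2)" using dist_conv[OF u\<^sub>0] by (rule convergent_imp_Bseq)
    then obtain K where K: "\<And>n. (norm (x n - u\<^sub>0))\<^sup>2 \<le> K" unfolding Bseq_def by auto
    define R where "R = norm u\<^sub>0 + sqrt K"
    have x_R: "norm (x n) \<le> R" for n
      using real_le_rsqrt[OF K[of n]] norm_triangle_ineq2[of "x n" u\<^sub>0] unfolding R_def by simp
    have "norm (z n) \<le> R" for n
    proof -
      have "norm (\<Sum>k\<le>n. lam k *\<^sub>R x k) \<le> (\<Sum>k\<le>n. lam k * R)"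
        using pos(1) x_R by (intro sum_norm_le) (auto intro: mult_left_mono less_imp_le simp: abs_of_pos)
      also have "\<dots> = \<tau> n * R" by (simp add: tau sum_distrib_right)
      finally show ?thesis using tau_pos[of n] by (simp add: z field_simps)
    qed
    then show ?thesis by (auto simp: bounded_iff)
  qed
  moreover have "convergent (\<lambda>n. z n \<bullet> (u - v))" if "u \<in> zer T" "v \<in> zer T" for u v
  proof -
    \<comment> \<open>Polarisation expresses the product through two squared distances, each known
      to converge; averaging preserves the limit.\<close>
    have "x n \<bullet> (u - v) = ((norm (x n - v))\<^sup>2 - (norm (x n - u))\<^sup>2 + (u \<bullet> u - v \<bullet> v)) * (1/2)" for n
      by (simp add: power2_norm_eq_inner inner_diff_left inner_diff_right inner_commute field_simps)
    moreover have "convergent (\<lambda>n. ((norm (x n - v))\<^sup>2 - (norm (x n - u))\<^sup>2 + (u \<bullet> u - v \<bullet> v)) * (1/2))"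
      by (intro convergent_mult convergent_add convergent_diff dist_conv that convergent_const)
    ultimately obtain l where "(\<lambda>n. x n \<bullet> (u - v)) \<longlonglongrightarrow> l" by (auto simp: convergent_def)
    from weighted_average_tendsto[OF this pos(1) tau_top] show ?thesis
      unfolding z_inner by (rule convergentI)
  qed

  \<comment> \<open>Weak cluster points of the averages are zeros\<close>
  moreover have "q \<in> zer T"
    if r: "strict_mono (r :: nat \<Rightarrow> nat)"
      "\<And>h c. \<forall>\<^sub>F n in sequentially. z (r n) \<bullet> h \<le> c \<Longrightarrow> q \<bullet> h \<le> c" for q r
  proof -
    have "q \<bullet> w \<le> u \<bullet> w" if "w \<in> T u" for u w
    proof -
      obtain s where s: "summable s" "\<And>n. 0 \<le> s n" "\<And>n. n \<ge> N \<Longrightarrow>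
        ((norm (x (Suc n) - u))\<^sup>2 + e (Suc n)) + (c * d n + 2 * (lam n * ((Y (Suc n) - u) \<bullet> w)))
        \<le> ((norm (x n - u))\<^sup>2 + e n) + s n"
        using energy[OF \<open>w \<in> T u\<close>] by blast
      \<comment> \<open>The price of replacing \<open>Y (Suc n)\<close> by \<open>x n\<close>, from
        \<open>2ab \<le> a\<^sup>2 + b\<^sup>2\<close>; it is summable because the step lengths are
        square summable.\<close>
      define g where "g n = (lam n)\<^sup>2 * (norm w)\<^sup>2 + f n" for n
      have g: "2 * (lam n * ((x n - Y (Suc n)) \<bullet> w)) \<le> g n" for n
      proof -
        have "lam n * ((x n - Y (Suc n)) \<bullet> w) \<le> lam n * (norm (x n - Y (Suc n)) * norm w)"
          using pos(1)[of n] by (intro mult_left_mono norm_cauchy_schwarz) auto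
        moreover have "2 * (lam n * (norm (x n - Y (Suc n)) * norm w)) \<le> g n"
          using sum_squares_bound[of "lam n * norm w" "norm (x n - Y (Suc n))"]
          by (simp add: g_def f_def power_mult_distrib mult_ac)
        ultimately show ?thesis by simp
      qed
      have sum_sg: "summable (\<lambda>n. s n + g n)"
        unfolding g_def using s(1) sum_f iii(1) by (intro summable_add summable_mult2) auto
      define t where "t n = 2 * (lam n * ((x n - u) \<bullet> w))" for n
      have step: "((norm (x (Suc n) - u))\<^sup>2 + e (Suc n)) + t n
          \<le> ((norm (x n - u))\<^sup>2 + e n) + (s n + g n)" if "n \<ge> N" for n
      proof -
        have "t n = 2 * (lam n * ((Y (Suc n) - u) \<bullet> w)) + 2 * (lam n * ((x n - Y (Suc n)) \<bullet> w))"
          by (simp add: t_def inner_diff_left algebra_simps)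
        moreover have "0 \<le> c * d n" using \<open>c > 0\<close> by (simp add: d_def)
        ultimately show ?thesis using s(3)[OF that] g[of n] by linarith
      qed
      obtain K where K: "\<And>n. n \<ge> N \<Longrightarrow> (\<Sum>k<n. t k) \<le> K"
        using quasi_decreasing_partial_sums[OF step _ _ sum_sg] s(2)
        by (auto simp: e_def g_def f_def)
      have z_le: "z n \<bullet> w \<le> u \<bullet> w + K / 2 / \<tau> n" if "n \<ge> N" for n
      proof -
        have zt: "\<tau> n * (z n \<bullet> w) = (\<Sum>k\<le>n. lam k * (x k \<bullet> w))"
          using tau_pos[of n] unfolding z_inner tau by simp
        have "(\<Sum>k<Suc n. t k) = 2 * (\<tau> n * (z n \<bullet> w) - \<tau> n * (u \<bullet> w))"
          unfolding t_def lessThan_Suc_atMost zt unfolding tau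
          by (simp add: inner_diff_left right_diff_distrib sum_subtractf sum_distrib_left sum_distrib_right)
        then show ?thesis using K[of "Suc n"] that tau_pos[of n] by (simp add: field_simps)
      qed
      have "(\<lambda>n. u \<bullet> w + K / 2 / \<tau> n) \<longlonglongrightarrow> u \<bullet> w + 0"
        using tau_top unfolding tau
        by (intro tendsto_intros real_tendsto_divide_at_top[OF tendsto_const])
      then have lim: "(\<lambda>n. u \<bullet> w + K / 2 / \<tau> n) \<longlonglongrightarrow> u \<bullet> w" by simp
      show ?thesis
      proof (rule field_le_epsilon)
        fix \<epsilon> :: real assume "\<epsilon> > 0"
        then have "\<forall>\<^sub>F n in sequentially. u \<bullet> w + K / 2 / \<tau> n < u \<bullet> w + \<epsilon>"
          by (intro order_tendstoD(2)[OF lim]) simp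
        then have "\<forall>\<^sub>F n in sequentially. z n \<bullet> w \<le> u \<bullet> w + \<epsilon>"
          using eventually_ge_at_top[of N] by eventually_elim (use z_le in force)
        then show "q \<bullet> w \<le> u \<bullet> w + \<epsilon>"
          by (intro r(2) eventually_subseq[OF r(1)])
      qed
    qed
    \<comment> \<open>This says that \<open>(q, 0)\<close> is monotonically related to the graph of
      \<open>T\<close>.\<close>
    then have "\<forall>u w. w \<in> T u \<longrightarrow> 0 \<le> (q - u) \<bullet> (0 - w)" by (simp add: inner_diff_left)
    then show ?thesis using T_max unfolding maximally_monotone_iff zer_def by blast
  qed
  ultimately show ?thesis unfolding T_def[symmetric] by (rule weak_convergence_if_cluster_points)
qed

end
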